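(* Let $G$ be a finite non-cyclic group. For $x\in G$, let $\mathrm{M}_x$ be the union of all the maximal cyclic subgroups of $G$ containing $x$. Then the graph $\overline{\mathcal{P}_E(G^* )}$ is Eulerian if and only if either $|G|$ is odd or $|\mathrm{M}_x|$ is even for every $x\in V(\overline{\mathcal{P}_E(G^* )})$.
   Context: The enhanced power graph $\mathcal{P}_E(G)$ of a group $G$ is the simple undirected graph with vertex set $G$ in which two distinct vertices $x,y$ are adjacent if $x,y\in\langle z\rangle$ for some $z\in G$. Its complement $\overline{\mathcal{P}_E(G)}$ has the same vertex set $G$, and distinct $x,y$ are adjacent in it if and only if they are not adjacent in $\mathcal{P}_E(G)$. The graph $\overline{\mathcal{P}_E(G^* )}$ is the subgraph of $\overline{\mathcal{P}_E(G)}$ induced by all the non-isolated vertices of $\overline{\mathcal{P}_E(G)}$, and $V(\cdot)$ denotes the vertex set. A maximal cyclic subgroup of $G$ is a cyclic subgroup of $G$ not properly contained in any other cyclic subgroup of $G$. A graph is Eulerian if it is connected and has a closed trail (closed walk with no repeated edge) containing all its edges. *)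

theory Defs
  imports
    "HOL-Algebra.Elementary_Groups"
    "HOL-Algebra.Coset"
    "Graph_Theory.Digraph_Component"
begin

text \<open>
  Following the Graph_Theory library, a simple undirected graph is a symmetric loopfree
  digraph without parallel arcs: the edge \<open>{x, y}\<close> is represented by the two arcs
  \<open>(x, y)\<close> and \<open>(y, x)\<close>.
\<close>

definition enhanced_power_graph :: "('a, 'b) monoid_scheme \<Rightarrow> 'a pair_pre_digraph" where
  "enhanced_power_graph G =
    \<lparr> pverts = carrier G,
      parcs = {(x, y). x \<in> carrier G \<and> y \<in> carrier G \<and> x \<noteq> y \<and>
                 (\<exists>z\<in>carrier G. x \<in> generate G {z} \<and> y \<in> generate G {z})} \<rparr>"

definition graph_complement :: "'a pair_pre_digraph \<Rightarrow> 'a pair_pre_digraph" where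
  "graph_complement \<Gamma> =
    \<lparr> pverts = pverts \<Gamma>,
      parcs = {(x, y). x \<in> pverts \<Gamma> \<and> y \<in> pverts \<Gamma> \<and> x \<noteq> y \<and> (x, y) \<notin> parcs \<Gamma>} \<rparr>"

definition non_isolated_verts :: "'a pair_pre_digraph \<Rightarrow> 'a set" where
  "non_isolated_verts \<Gamma> = {x \<in> pverts \<Gamma>. \<exists>y. (x, y) \<in> parcs \<Gamma>}"

definition complement_epg_star :: "('a, 'b) monoid_scheme \<Rightarrow> ('a, 'a \<times> 'a) pre_digraph" where
  "complement_epg_star G =
    (let \<Gamma> = graph_complement (enhanced_power_graph G)
     in induce_subgraph (with_proj \<Gamma>) (non_isolated_verts \<Gamma>))"

definition cyclic_subgroup :: "('a, 'b) monoid_scheme \<Rightarrow> 'a set \<Rightarrow> bool" where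
  "cyclic_subgroup G H \<longleftrightarrow> subgroup H G \<and> cyclic_group (G\<lparr>carrier := H\<rparr>)"

definition maximal_cyclic_subgroup :: "('a, 'b) monoid_scheme \<Rightarrow> 'a set \<Rightarrow> bool" where
  "maximal_cyclic_subgroup G H \<longleftrightarrow>
    cyclic_subgroup G H \<and> \<not> (\<exists>K. cyclic_subgroup G K \<and> H \<subset> K)"

definition M_of :: "('a, 'b) monoid_scheme \<Rightarrow> 'a \<Rightarrow> 'a set" where
  "M_of G x = \<Union> {H. maximal_cyclic_subgroup G H \<and> x \<in> H}"

text \<open>
  The library's \<open>trail\<close> and \<open>euler_trail\<close> only forbid repeating an arc, so in a symmetric
  digraph they may use an undirected edge once in each direction. The undirected notion below
  therefore compares the underlying edges instead of the arcs. It is meant for symmetric digraphs.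
  As usual in the library, a connected graph has at least one vertex.
\<close>

definition undirected_edge :: "('a, 'b) pre_digraph \<Rightarrow> 'b \<Rightarrow> 'a set" where
  "undirected_edge \<Gamma> e = {tail \<Gamma> e, head \<Gamma> e}"

definition undirected_trail :: "('a, 'b) pre_digraph \<Rightarrow> 'a \<Rightarrow> 'b awalk \<Rightarrow> 'a \<Rightarrow> bool" where
  "undirected_trail \<Gamma> u p v \<longleftrightarrow>
    pre_digraph.awalk \<Gamma> u p v \<and> distinct (map (undirected_edge \<Gamma>) p)"

definition eulerian :: "('a, 'b) pre_digraph \<Rightarrow> bool" where
  "eulerian \<Gamma> \<longleftrightarrow>
    Digraph_Component.connected \<Gamma> \<and>
    (\<exists>u p. undirected_trail \<Gamma> u p u \<and>
           undirected_edge \<Gamma> ` set p = undirected_edge \<Gamma> ` arcs \<Gamma>)"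

lemma (in group) cyclic_subgroup_iff_generate:
  "cyclic_subgroup G H \<longleftrightarrow> (\<exists>x\<in>carrier G. H = generate G {x})"
proof
  assume "cyclic_subgroup G H"
  then have H: "subgroup H G" and "cyclic_group (G\<lparr>carrier := H\<rparr>)"
    by (auto simp: cyclic_subgroup_def)
  then obtain x where x: "x \<in> H" "subgroup_generated (G\<lparr>carrier := H\<rparr>) {x} = G\<lparr>carrier := H\<rparr>"
    by (auto simp: cyclic_group_def)
  have "carrier (subgroup_generated (G\<lparr>carrier := H\<rparr>) {x}) = H"
    using x(2) by simp
  then have "generate (G\<lparr>carrier := H\<rparr>) {x} = H"
    using x(1) by (simp add: carrier_subgroup_generated)
  moreover have "generate (G\<lparr>carrier := H\<rparr>) {x} = generate G {x}"
    by (rule generate_consistent[OF _ H]) (use x(1) in blast)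
  ultimately have "H = generate G {x}"
    by (rule trans[OF sym])
  moreover have "x \<in> carrier G"
    using subgroup.mem_carrier[OF H x(1)] .
  ultimately show "\<exists>x\<in>carrier G. H = generate G {x}"
    by (rule bexI)
next
  assume "\<exists>x\<in>carrier G. H = generate G {x}"
  then obtain x where x: "x \<in> carrier G" "H = generate G {x}" by blast
  have "subgroup H G"
    unfolding x(2) by (rule generate_is_subgroup) (use x(1) in simp)
  moreover have "G\<lparr>carrier := H\<rparr> = subgroup_generated G {x}"
    unfolding x(2) subgroup_generated_def using x(1) by simp
  ultimately show "cyclic_subgroup G H"
    using cyclic_group_generated[of x] by (simp add: cyclic_subgroup_def)
qed

lemma complement_epg_star_graph:
  assumes "finite (carrier G)"
  shows "graph (complement_epg_star G)"
proof -
  let ?A = "arcs (complement_epg_star G)"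
  have "?A \<subseteq> carrier G \<times> carrier G"
    by (auto simp: complement_epg_star_def graph_complement_def enhanced_power_graph_def Let_def)
  with assms have "finite ?A"
    using finite_subset by blast
  then show ?thesis
    using assms
    by unfold_locales
       (auto simp: complement_epg_star_def graph_complement_def enhanced_power_graph_def
          non_isolated_verts_def Let_def arc_to_ends_def symmetric_conv)
qed

end

theory Submission
  imports Defs "HOL-Algebra.Multiplicative_Group" "Graph_Theory.Euler"
begin

text \<open>
  In \<open>complement_epg_star G\<close> the neighbours of a vertex \<open>x\<close> are exactly the elements that share no
  cyclic subgroup with \<open>x\<close>, that is, the elements outside \<open>M_of G x\<close>. So the degree of \<open>x\<close> is
  \<open>order G - card (M_of G x)\<close> (lemma \<open>out_degree_star\<close>). If \<open>order G\<close> is even, all degrees are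
  therefore even iff all the numbers \<open>card (M_of G x)\<close> are. If \<open>order G\<close> is odd, all degrees are
  even, because \<open>M_of G x\<close> is a union of subgroups and inversion pairs off its elements other than
  the identity (lemma \<open>odd_card_M_of\<close>).

  By Euler's theorem it remains to see that the graph is connected
  (lemma \<open>connected_star\<close>). The generators of maximal cyclic subgroups are the hubs. If \<open>z\<close>
  generates a maximal cyclic subgroup, then \<open>M_of G z\<close> is that subgroup, so \<open>z\<close> is adjacent to
  everything outside it. Two hubs with different subgroups are adjacent; two
  hubs with the same subgroup have a common neighbour, since \<open>G\<close> is not cyclic. Finally, a vertex
  \<open>x\<close> is adjacent to some \<open>y\<close>, and then \<open>x\<close> is also adjacent to the generator of any maximal cyclic
  subgroup containing \<open>y\<close>.

  Euler's theorem is needed for undirected graphs, where a trail may use each edge in only one of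
  its two directions (lemma \<open>eulerian_iff_even_degrees\<close>). The proof looks at a longest trail:
  parity of the degrees forces it to be closed, and connectedness forces it to cover every edge,
  since otherwise it could be rotated to a vertex with an unused edge and prolonged.
\<close>

section \<open>Euler's theorem for undirected graphs\<close>

definition edges_at :: "('a, 'b) pre_digraph \<Rightarrow> 'a \<Rightarrow> 'b set \<Rightarrow> 'a set set" where
  "edges_at \<Gamma> w S = {E \<in> undirected_edge \<Gamma> ` S. w \<in> E}"

context graph
begin

lemma undirected_edge_eq_iff:
  assumes "e \<in> arcs G" "f \<in> arcs G" "tail G e = tail G f"
  shows "undirected_edge G e = undirected_edge G f \<longleftrightarrow> e = f"
proof
  assume "undirected_edge G e = undirected_edge G f"
  then have "head G e = head G f"
    using assms(3) by (auto simp: undirected_edge_def doubleton_eq_iff)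
  then show "e = f"
    using assms by (intro no_multi_arcs) (auto simp: arc_to_ends_def)
qed simp

text \<open>Symmetry lets each edge at \<open>w\<close> be represented by the one of its two arcs that leaves \<open>w\<close>.\<close>

lemma edges_at_arcs: "edges_at G w (arcs G) = undirected_edge G ` out_arcs G w"
proof -
  have "undirected_edge G e \<in> undirected_edge G ` out_arcs G w"
    if "e \<in> arcs G" "w \<in> undirected_edge G e" for e
  proof (cases "tail G e = w")
    case False
    obtain f where "f \<in> arcs G" "tail G e = head G f" "head G e = tail G f"
      using sym_arcs \<open>e \<in> arcs G\<close> unfolding symmetric_conv by blast
    then have "f \<in> out_arcs G w" "undirected_edge G e = undirected_edge G f"
      using that False by (auto simp: undirected_edge_def)
    then show ?thesis by blast
  qed (use that in auto)
  then show ?thesis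
    by (auto simp: edges_at_def) (auto simp: undirected_edge_def)
qed

lemma card_edges_at_arcs: "card (edges_at G w (arcs G)) = out_degree G w"
  unfolding edges_at_arcs out_degree_def
  by (intro card_image inj_onI) (auto simp: undirected_edge_eq_iff)

text \<open>
  A walk leaves every inner visit to \<open>w\<close> again, so the arcs at \<open>w\<close> come in pairs except at the two
  ends. Loops would count once instead of twice; a graph has none.
\<close>

lemma even_arcs_at_iff:
  assumes "awalk u p v"
  shows "even (length (filter (\<lambda>e. w \<in> undirected_edge G e) p)) \<longleftrightarrow> (w = u \<longleftrightarrow> w = v)"
  using assms
proof (induction p arbitrary: u)
  case Nil
  then show ?case by (auto simp: awalk_Nil_iff)
next
  case (Cons e p)
  then have "awalk (head G e) p v" "tail G e = u" "tail G e \<noteq> head G e"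
    using no_loops by (auto simp: awalk_Cons_iff)
  then show ?case
    using Cons.IH[of "head G e"] by (auto simp: undirected_edge_def)
qed

lemma even_edges_at_trail_iff:
  assumes "undirected_trail G u p v"
  shows "even (card (edges_at G w (set p))) \<longleftrightarrow> (w = u \<longleftrightarrow> w = v)"
proof -
  let ?es = "filter (\<lambda>E. w \<in> E) (map (undirected_edge G) p)"
  have "distinct ?es"
    using assms by (simp add: undirected_trail_def del: filter_map)
  then have "card (edges_at G w (set p)) = length ?es"
    using distinct_card[of ?es] by (simp add: edges_at_def)
  also have "\<dots> = length (filter (\<lambda>e. w \<in> undirected_edge G e) p)"
    by (simp add: filter_map comp_def)
  finally show ?thesis
    using assms even_arcs_at_iff by (simp add: undirected_trail_def)
qed

lemma undirected_trail_snoc: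
  assumes "undirected_trail G u p v" "e \<in> arcs G" "tail G e = v"
    and "undirected_edge G e \<notin> undirected_edge G ` set p"
  shows "undirected_trail G u (p @ [e]) (head G e)"
  using assms
  by (auto simp: undirected_trail_def awalk_Cons_iff awalk_Nil_iff intro!: awalk_appendI)

lemma rotate_undirected_trail:
  assumes "undirected_trail G u p u" "w \<in> set (awalk_verts u p)"
  obtains q where "undirected_trail G w q w" "set q = set p" "length q = length p"
proof -
  obtain q r where "p = q @ r" "awalk w (r @ q) w"
    using rotate_awalkE assms unfolding undirected_trail_def by metis
  then have "undirected_trail G w (r @ q) w"
    using assms(1) by (auto simp: undirected_trail_def)
  with \<open>p = q @ r\<close> show thesis by (intro that[of "r @ q"]) auto
qed

lemma undirected_trail_length_le:
  assumes "undirected_trail G u p v"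
  shows "length p \<le> card (arcs G)"
proof -
  have "distinct p" "set p \<subseteq> arcs G"
    using assms by (auto simp: undirected_trail_def distinct_map)
  then show ?thesis
    using card_mono[OF finite_arcs, of "set p"] distinct_card[of p] by simp
qed

text \<open>
  If every arc leaving a vertex of the trail were used, the vertices of the trail would be closed
  under adjacency, hence be all vertices, and then no arc would be left over.
\<close>

lemma unused_edge_at_trail:
  assumes "connected G" "undirected_trail G u p v"
    and "undirected_edge G ` set p \<noteq> undirected_edge G ` arcs G"
  shows "\<exists>e\<in>arcs G. tail G e \<in> set (awalk_verts u p) \<and>
    undirected_edge G e \<notin> undirected_edge G ` set p"
proof (rule ccontr)
  assume "\<not> ?thesis"
  then have used: "undirected_edge G e \<in> undirected_edge G ` set p"
    if "e \<in> arcs G" "tail G e \<in> set (awalk_verts u p)" for e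
    using that by blast
  have p: "awalk u p v"
    using assms(2) by (simp add: undirected_trail_def)
  then have "u \<in> verts G" "set p \<subseteq> arcs G" by auto
  have closed: "head G e \<in> set (awalk_verts u p)"
    if e: "e \<in> arcs G" "tail G e \<in> set (awalk_verts u p)" for e
  proof -
    obtain f where f: "f \<in> set p" "undirected_edge G e = undirected_edge G f"
      using used[OF e] by (rule imageE)
    then have "head G e \<in> {tail G f, head G f}"
      by (auto simp: undirected_edge_def doubleton_eq_iff)
    then show ?thesis
      using awalk_verts_arc1[OF f(1), of u] awalk_verts_arc2[OF p f(1)] by auto
  qed
  have "x \<in> set (awalk_verts u p)" if "x \<in> verts G" for x
  proof -
    have "u \<rightarrow>\<^sup>* x"
      using symmetric_connected_imp_strongly_connected[OF sym_arcs assms(1)] \<open>u \<in> verts G\<close> that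
      by (auto simp: strongly_connected_def)
    then show ?thesis
    proof (induction rule: reachable_induct)
      case base
      show ?case using p by (rule hd_in_awalk_verts)
    next
      case (step y z)
      then show ?case using closed by (auto simp: arcs_ends_def arc_to_ends_def)
    qed
  qed
  then have "undirected_edge G ` arcs G \<subseteq> undirected_edge G ` set p"
    using used by auto
  moreover have "undirected_edge G ` set p \<subseteq> undirected_edge G ` arcs G"
    using \<open>set p \<subseteq> arcs G\<close> by (rule image_mono)
  ultimately show False using assms(3) by simp
qed

theorem eulerian_iff_even_degrees:
  assumes "connected G"
  shows "eulerian G \<longleftrightarrow> (\<forall>x\<in>verts G. even (out_degree G x))"
proof
  assume "eulerian G"
  then obtain u p where p: "undirected_trail G u p u"
    "undirected_edge G ` set p = undirected_edge G ` arcs G"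
    by (auto simp: eulerian_def)
  have "even (out_degree G x)" for x
    using even_edges_at_trail_iff[OF p(1), of x] p(2)
    unfolding card_edges_at_arcs[symmetric] by (simp add: edges_at_def)
  then show "\<forall>x\<in>verts G. even (out_degree G x)" by blast
next
  assume even: "\<forall>x\<in>verts G. even (out_degree G x)"
  define T where "T n \<longleftrightarrow> (\<exists>u p v. undirected_trail G u p v \<and> length p = n)" for n
  have T: "T (length p)" if "undirected_trail G u p v" for u p v
    using that unfolding T_def by blast
  obtain u0 where "u0 \<in> verts G"
    using assms by (auto simp: connected_def strongly_connected_def)
  then have "undirected_trail G u0 [] u0"
    by (simp add: undirected_trail_def awalk_Nil_iff)
  then have "T 0" using T[of u0 "[]" u0] by simp
  moreover have "\<forall>n. T n \<longrightarrow> n \<le> card (arcs G)"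
    using undirected_trail_length_le by (auto simp: T_def)
  ultimately obtain n where "T n" and maxn: "\<forall>m. T m \<longrightarrow> m \<le> n"
    using Nat.ex_has_greatest_nat[of T 0 "card (arcs G)"] by metis
  then obtain u p v where p: "undirected_trail G u p v" "length p = n"
    by (auto simp: T_def)
  have longest: "undirected_edge G e \<in> undirected_edge G ` set q"
    if "undirected_trail G a q b" "length q = n" "e \<in> arcs G" "tail G e = b" for a q b e
  proof (rule ccontr)
    assume "undirected_edge G e \<notin> undirected_edge G ` set q"
    then have "undirected_trail G a (q @ [e]) (head G e)"
      by (rule undirected_trail_snoc[OF that(1,3,4)])
    then have "T (Suc n)"
      using T[of a "q @ [e]" "head G e"] \<open>length q = n\<close> by simp
    then show False using maxn by auto
  qed
  have "set p \<subseteq> arcs G" "v \<in> verts G"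
    using p(1) by (auto simp: undirected_trail_def)
  \<comment> \<open>A longest trail uses all edges at its end \<open>v\<close>, an even number, so \<open>v\<close> is also its start.\<close>
  have "edges_at G v (set p) = edges_at G v (arcs G)"
  proof
    show "edges_at G v (set p) \<subseteq> edges_at G v (arcs G)"
      using \<open>set p \<subseteq> arcs G\<close> by (auto simp: edges_at_def)
    show "edges_at G v (arcs G) \<subseteq> edges_at G v (set p)"
      unfolding edges_at_arcs
      using longest[OF p] by (auto simp: edges_at_def) (auto simp: undirected_edge_def)
  qed
  then have "even (card (edges_at G v (set p)))"
    using even \<open>v \<in> verts G\<close> by (simp add: card_edges_at_arcs)
  then have "u = v"
    using even_edges_at_trail_iff[OF p(1), of v] by simp
  have "undirected_edge G ` set p = undirected_edge G ` arcs G"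
  proof (rule ccontr)
    assume "undirected_edge G ` set p \<noteq> undirected_edge G ` arcs G"
    from unused_edge_at_trail[OF assms p(1) this] obtain e where
      e: "e \<in> arcs G" "tail G e \<in> set (awalk_verts u p)"
        "undirected_edge G e \<notin> undirected_edge G ` set p"
      by blast
    have "undirected_trail G u p u"
      using p(1) \<open>u = v\<close> by simp
    then obtain q where q: "undirected_trail G (tail G e) q (tail G e)"
      "set q = set p" "length q = length p"
      using e(2) by (rule rotate_undirected_trail)
    have "undirected_edge G e \<in> undirected_edge G ` set q"
      using q(3) p(2) e(1) by (intro longest[OF q(1)]) simp_all
    with q(2) e(3) show False by simp
  qed
  with assms p(1) \<open>u = v\<close> show "eulerian G"
    unfolding eulerian_def by (intro conjI exI[of _ u] exI[of _ p]) simp_all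
qed

end

section \<open>Maximal cyclic subgroups and the sets \<open>M_of G x\<close>\<close>

locale finite_group = group +
  assumes finite_carrier: "finite (carrier G)"
begin

lemma self_in_generate: "x \<in> carrier G \<Longrightarrow> x \<in> generate G {x}"
  by (simp add: generate.incl)

lemma generate_singleton_mono:
  assumes "z \<in> carrier G" "x \<in> generate G {z}"
  shows "generate G {x} \<subseteq> generate G {z}"
  using assms by (intro generate_subgroup_incl generate_is_subgroup) auto

lemma ex_maximal_generator:
  assumes "z \<in> carrier G"
  obtains m where "m \<in> carrier G" "maximal_cyclic_subgroup G (generate G {m})"
    "generate G {z} \<subseteq> generate G {m}"
proof -
  let ?C = "{H. cyclic_subgroup G H}"
  have "?C \<subseteq> Pow (carrier G)"
    by (auto simp: cyclic_subgroup_def dest: subgroup.subset)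
  then have "finite ?C"
    using finite_carrier finite_subset by auto
  moreover have "generate G {z} \<in> ?C"
    using assms by (auto simp: cyclic_subgroup_iff_generate)
  ultimately obtain M where M: "M \<in> ?C" "generate G {z} \<subseteq> M" "\<forall>K\<in>?C. M \<subseteq> K \<longrightarrow> M = K"
    using finite_has_maximal2[of ?C "generate G {z}"] by blast
  then obtain m where "m \<in> carrier G" "M = generate G {m}"
    by (auto simp: cyclic_subgroup_iff_generate)
  moreover have "maximal_cyclic_subgroup G M"
    using M by (auto simp: maximal_cyclic_subgroup_def)
  ultimately show thesis using that M by blast
qed

text \<open>Enlarging a common cyclic subgroup of \<open>x\<close> and \<open>y\<close> to a maximal one keeps both elements.\<close>

lemma mem_M_of_iff:
  "y \<in> M_of G x \<longleftrightarrow> (\<exists>z\<in>carrier G. x \<in> generate G {z} \<and> y \<in> generate G {z})"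
proof
  assume "y \<in> M_of G x"
  then obtain H where "cyclic_subgroup G H" "x \<in> H" "y \<in> H"
    by (auto simp: M_of_def maximal_cyclic_subgroup_def)
  then show "\<exists>z\<in>carrier G. x \<in> generate G {z} \<and> y \<in> generate G {z}"
    unfolding cyclic_subgroup_iff_generate by blast
next
  assume "\<exists>z\<in>carrier G. x \<in> generate G {z} \<and> y \<in> generate G {z}"
  then obtain z where "z \<in> carrier G" "x \<in> generate G {z}" "y \<in> generate G {z}" by blast
  moreover from this obtain m where
    "maximal_cyclic_subgroup G (generate G {m})" "generate G {z} \<subseteq> generate G {m}"
    using ex_maximal_generator by metis
  ultimately show "y \<in> M_of G x"
    unfolding M_of_def by blast
qed

lemma M_of_commute: "y \<in> M_of G x \<longleftrightarrow> x \<in> M_of G y"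
  by (auto simp: mem_M_of_iff)

lemma self_in_M_of: "x \<in> carrier G \<Longrightarrow> x \<in> M_of G x"
  unfolding mem_M_of_iff by (rule bexI[of _ x]) (simp_all add: self_in_generate)

lemma M_of_subset_carrier: "M_of G x \<subseteq> carrier G"
proof
  fix y assume "y \<in> M_of G x"
  then obtain z where "z \<in> carrier G" "y \<in> generate G {z}"
    by (auto simp: mem_M_of_iff)
  then show "y \<in> carrier G"
    using generate_in_carrier[of "{z}" y] by simp
qed

lemma M_of_maximal_generator:
  assumes "m \<in> carrier G" "maximal_cyclic_subgroup G (generate G {m})"
  shows "M_of G m = generate G {m}"
proof
  show "M_of G m \<subseteq> generate G {m}"
  proof
    fix y assume "y \<in> M_of G m"
    then obtain z where z: "z \<in> carrier G" "m \<in> generate G {z}" "y \<in> generate G {z}"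
      by (auto simp: mem_M_of_iff)
    then have "cyclic_subgroup G (generate G {z})" "generate G {m} \<subseteq> generate G {z}"
      using generate_singleton_mono by (auto simp: cyclic_subgroup_iff_generate)
    then have "generate G {m} = generate G {z}"
      using assms(2) by (auto simp: maximal_cyclic_subgroup_def)
    with z show "y \<in> generate G {m}" by simp
  qed
next
  show "generate G {m} \<subseteq> M_of G m"
    using assms(1) self_in_generate[of m] by (auto simp: mem_M_of_iff)
qed

lemma inv_in_M_of:
  assumes "y \<in> M_of G x"
  shows "inv y \<in> M_of G x"
proof -
  obtain z where z: "z \<in> carrier G" "x \<in> generate G {z}" "y \<in> generate G {z}"
    using assms by (auto simp: mem_M_of_iff)
  then have "inv y \<in> generate G {z}"
    by (intro generate_m_inv_closed) auto
  with z show ?thesis by (auto simp: mem_M_of_iff)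
qed

lemma odd_order_no_involution:
  assumes "odd (order G)" "y \<in> carrier G" "inv y = y"
  shows "y = \<one>"
proof -
  have "y [^] (2::nat) = \<one>"
    using assms(2,3) r_inv[of y] by (simp add: numeral_2_eq_2)
  then have "ord y dvd 2"
    using pow_eq_id[OF assms(2)] by simp
  then have "ord y \<le> 2" by (rule dvd_imp_le) simp
  moreover have "odd (ord y)"
    using assms(1) dvd_trans[OF _ ord_dvd_group_order[OF assms(2)], of 2] by auto
  then have "0 < ord y" "ord y \<noteq> 2" by (auto intro: odd_pos)
  ultimately have "ord y = 1" by linarith
  then show ?thesis using ord_eq_1[OF assms(2)] by simp
qed

lemma odd_card_M_of:
  assumes "odd (order G)" "x \<in> carrier G"
  shows "odd (card (M_of G x))"
proof -
  let ?A = "M_of G x - {\<one>}"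
  let ?P = "(\<lambda>y. {y, inv y}) ` ?A"
  have carrier: "y \<in> carrier G" if "y \<in> M_of G x" for y
    using that M_of_subset_carrier[of x] by auto
  have fin: "finite (M_of G x)"
    using M_of_subset_carrier finite_carrier by (rule finite_subset)
  have "\<Union>?P = ?A"
  proof
    show "\<Union>?P \<subseteq> ?A"
      using inv_in_M_of[of _ x] carrier inv_eq_1_iff by auto
    show "?A \<subseteq> \<Union>?P" by blast
  qed
  moreover have "2 dvd card (\<Union>?P)"
  proof (rule dvd_partition)
    show "finite (\<Union>?P)" using fin \<open>\<Union>?P = ?A\<close> by simp
    have "card {y, inv y} = 2" if "y \<in> ?A" for y
      using odd_order_no_involution[OF assms(1), of y] carrier that by (auto simp: card_insert_if)
    then show "\<forall>c\<in>?P. 2 dvd card c" by auto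
    show "\<forall>c1\<in>?P. \<forall>c2\<in>?P. c1 \<noteq> c2 \<longrightarrow> c1 \<inter> c2 = {}"
      using carrier by auto
  qed
  ultimately have "even (card ?A)" by simp
  moreover have "\<one> \<in> M_of G x"
    unfolding mem_M_of_iff
    by (rule bexI[of _ x]) (simp_all add: assms(2) self_in_generate generate.one)
  then have "card (M_of G x) = Suc (card ?A)"
    using card_Suc_Diff1[OF fin] by simp
  ultimately show ?thesis by simp
qed

section \<open>The complement of the enhanced power graph\<close>

lemma arcs_star:
  "arcs (complement_epg_star G) = {(x, y). x \<in> carrier G \<and> y \<in> carrier G \<and> y \<notin> M_of G x}"
  and verts_star: "verts (complement_epg_star G) = {x \<in> carrier G. \<not> carrier G \<subseteq> M_of G x}"
  and tail_star: "tail (complement_epg_star G) = fst"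
  and head_star: "head (complement_epg_star G) = snd"
proof -
  let ?\<Gamma> = "graph_complement (enhanced_power_graph G)"
  have parcs: "parcs ?\<Gamma> = {(x, y). x \<in> carrier G \<and> y \<in> carrier G \<and> y \<notin> M_of G x}"
    using self_in_M_of
    by (auto simp: graph_complement_def enhanced_power_graph_def mem_M_of_iff)
  have "non_isolated_verts ?\<Gamma> = {x \<in> carrier G. \<not> carrier G \<subseteq> M_of G x}"
    unfolding non_isolated_verts_def parcs
    by (auto simp: graph_complement_def enhanced_power_graph_def)
  then show "verts (complement_epg_star G) = {x \<in> carrier G. \<not> carrier G \<subseteq> M_of G x}"
    and "arcs (complement_epg_star G) = {(x, y). x \<in> carrier G \<and> y \<in> carrier G \<and> y \<notin> M_of G x}"
    using M_of_commute by (auto simp: complement_epg_star_def Let_def parcs)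
  show "tail (complement_epg_star G) = fst" "head (complement_epg_star G) = snd"
    by (simp_all add: complement_epg_star_def Let_def)
qed

lemma dominates_star_iff:
  "x \<rightarrow>\<^bsub>complement_epg_star G\<^esub> y \<longleftrightarrow> x \<in> carrier G \<and> y \<in> carrier G \<and> y \<notin> M_of G x"
  by (auto simp: arcs_ends_def arc_to_ends_def arcs_star tail_star head_star)

lemma out_degree_star:
  assumes "x \<in> carrier G"
  shows "out_degree (complement_epg_star G) x = order G - card (M_of G x)"
proof -
  have "out_arcs (complement_epg_star G) x = Pair x ` (carrier G - M_of G x)"
    using assms by (auto simp: out_arcs_def arcs_star tail_star)
  then have "out_degree (complement_epg_star G) x = card (carrier G - M_of G x)"
    by (simp add: out_degree_def card_image inj_on_def)
  then show ?thesis
    using card_Diff_subset[OF finite_subset M_of_subset_carrier] M_of_subset_carrier finite_carrier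
    by (metis order_def)
qed

lemma connected_star:
  assumes "\<not> cyclic_group G"
  shows "connected (complement_epg_star G)"
proof -
  let ?\<Gamma> = "complement_epg_star G"
  interpret star: graph ?\<Gamma>
    using finite_carrier by (rule complement_epg_star_graph)
  define hub where
    "hub m \<longleftrightarrow> m \<in> carrier G \<and> maximal_cyclic_subgroup G (generate G {m})" for m
  have not_whole: "\<exists>y\<in>carrier G. y \<notin> generate G {m}" if "m \<in> carrier G" for m
  proof (rule ccontr)
    assume "\<not> ?thesis"
    then have "generate G {m} = carrier G"
      using that generate_in_carrier[of "{m}"] by blast
    then have "cyclic_subgroup G (carrier G)"
      using that by (auto simp: cyclic_subgroup_iff_generate)
    with assms show False by (simp add: cyclic_subgroup_def)
  qed
  have hub_adj: "m \<rightarrow>\<^bsub>?\<Gamma>\<^esub> y" if "hub m" "y \<in> carrier G" "y \<notin> generate G {m}" for m y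
    using that M_of_maximal_generator by (auto simp: dominates_star_iff hub_def)
  have hubs: "m \<rightarrow>\<^sup>*\<^bsub>?\<Gamma>\<^esub> n" if "hub m" "hub n" for m n
  proof (cases "n \<in> generate G {m}")
    case False
    then show ?thesis using hub_adj that by (auto simp: hub_def)
  next
    case True
    \<comment> \<open>Maximality of the smaller subgroup forces equality, so \<open>m\<close> and \<open>n\<close> have the same neighbours.\<close>
    then have "generate G {n} \<subseteq> generate G {m}"
      using that generate_singleton_mono by (auto simp: hub_def)
    then have same: "generate G {n} = generate G {m}"
      using that by (auto simp: hub_def maximal_cyclic_subgroup_def)
    obtain y where y: "y \<in> carrier G" "y \<notin> generate G {m}"
      using not_whole \<open>hub m\<close> by (auto simp: hub_def)
    have "m \<rightarrow>\<^bsub>?\<Gamma>\<^esub> y" "n \<rightarrow>\<^bsub>?\<Gamma>\<^esub> y"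
      using hub_adj that y same by auto
    moreover from this have "y \<rightarrow>\<^bsub>?\<Gamma>\<^esub> n"
      using M_of_commute by (auto simp: dominates_star_iff)
    ultimately show ?thesis
      using star.adj_reachable_trans star.reachable_adjI by metis
  qed
  have to_hub: "\<exists>m. hub m \<and> x \<rightarrow>\<^bsub>?\<Gamma>\<^esub> m" if x: "x \<in> verts ?\<Gamma>" for x
  proof -
    obtain y where y: "x \<in> carrier G" "y \<in> carrier G" "y \<notin> M_of G x"
      using x by (auto simp: verts_star)
    obtain m where m: "hub m" "generate G {y} \<subseteq> generate G {m}"
      using ex_maximal_generator[OF y(2)] by (auto simp: hub_def)
    then have "y \<in> generate G {m}"
      using self_in_generate y(2) by blast
    then have "x \<notin> generate G {m}"
      using y m(1) by (auto simp: mem_M_of_iff hub_def)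
    then have "m \<rightarrow>\<^bsub>?\<Gamma>\<^esub> x"
      using hub_adj m(1) y(1) by blast
    then show ?thesis
      using m(1) M_of_commute by (auto simp: dominates_star_iff)
  qed
  have "strongly_connected ?\<Gamma>"
  proof (rule strongly_connectedI)
    obtain m where "hub m"
      using ex_maximal_generator[OF one_closed] by (auto simp: hub_def)
    then have "m \<in> verts ?\<Gamma>"
      using not_whole hub_adj star.adj_in_verts(1) unfolding hub_def by metis
    then show "verts ?\<Gamma> \<noteq> {}" by blast
  next
    fix x y assume "x \<in> verts ?\<Gamma>" "y \<in> verts ?\<Gamma>"
    then obtain m n where mn: "hub m" "hub n" "x \<rightarrow>\<^bsub>?\<Gamma>\<^esub> m" "y \<rightarrow>\<^bsub>?\<Gamma>\<^esub> n"
      using to_hub by metis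
    then have "n \<rightarrow>\<^sup>*\<^bsub>?\<Gamma>\<^esub> y"
      using star.symmetric_reachable' star.reachable_adjI by blast
    with mn hubs show "x \<rightarrow>\<^sup>*\<^bsub>?\<Gamma>\<^esub> y"
      using star.adj_reachable_trans star.reachable_trans by metis
  qed
  then show ?thesis
    using star.reachable_mk_symmetric_eq[OF star.sym_arcs]
    by (simp add: connected_def strongly_connected_def)
qed

end

theorem theorem3p6:
  fixes G :: "('a, 'b) monoid_scheme"
  assumes "group G" and "finite (carrier G)" and "\<not> cyclic_group G"
  shows "eulerian (complement_epg_star G) \<longleftrightarrow>
    odd (order G) \<or> (\<forall>x\<in>verts (complement_epg_star G). even (card (M_of G x)))"
proof -
  interpret finite_group G
    using assms by (simp add: finite_group_def finite_group_axioms_def)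
  interpret star: graph "complement_epg_star G"
    using assms(2) by (rule complement_epg_star_graph)
  have "even (out_degree (complement_epg_star G) x) \<longleftrightarrow>
      odd (order G) \<or> even (card (M_of G x))" if "x \<in> verts (complement_epg_star G)" for x
  proof -
    have "x \<in> carrier G" using that by (simp add: verts_star)
    moreover have "card (M_of G x) \<le> order G"
      unfolding order_def using finite_carrier M_of_subset_carrier by (rule card_mono)
    ultimately show ?thesis
      using odd_card_M_of by (auto simp: out_degree_star)
  qed
  then show ?thesis
    using star.eulerian_iff_even_degrees[OF connected_star[OF assms(3)]] by blast
qed

end
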